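(* Let $G = (V, E)$ be a graph and $\rho \in \mathbb{Z}_+$ be a positive integer. Let $\mathcal{M} := (E, \mathcal{I})$ denote the pseudoforest matroid on the graph $G = (V, E)$, where a set of edges $E'\subseteq E$ is independent if every connected component of the subgraph $G' = (V, E')$ has at most one cycle. Let $\mathcal{M}_{\rho} := (E, \mathcal{I}_\rho)$ be the $\rho$-fold union of the pseudoforest matroid. Then, for every subset $F \subseteq V$, we have $E[V - F] \in \mathcal{I}_\rho$ if and only if $\lambda^*_{G - F} \leq \rho$.
   Context: For a graph $G=(V,E)$, $E[S]$ is the set of edges with both end vertices in $S$, and $\lambda^*_G:=\max\{|E[S]|/|S|:\emptyset\ne S\subseteq V\}$ (for a graph with no vertices the condition $\lambda^*_G\le\rho$ is considered to hold). For a positive integer $\rho$, the $\rho$-fold union of a matroid $\mathcal{M}=(E,\mathcal{I})$ is the matroid $\mathcal{M}_\rho=(E,\mathcal{I}_\rho)$ in which a set $A\subseteq E$ belongs to $\mathcal{I}_\rho$ if and only if $A$ can be partitioned into $\rho$ (possibly empty) parts, each of which belongs to $\mathcal{I}$. *)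

theory Defs
  imports Complex_Main "HOL-Library.Disjoint_Sets"
begin

section \<open>Finite undirected graphs\<close>

text \<open>
  Parallel edges and loops are allowed.  An edge is mapped to the set of its end vertices, which is
  a singleton for a loop.  Simple graphs are the instances whose edges are two-element vertex sets
  with \<open>ends\<close> the identity.
\<close>

record ('v, 'e) graph =
  verts :: "'v set"
  edges :: "'e set"
  ends  :: "'e \<Rightarrow> 'v set"

locale fin_graph =
  fixes G :: "('v, 'e) graph"
  assumes finite_verts: "finite (verts G)"
    and finite_edges: "finite (edges G)"
    and ends_in_verts: "e \<in> edges G \<Longrightarrow> ends G e \<subseteq> verts G"
    and card_ends: "e \<in> edges G \<Longrightarrow> card (ends G e) = 1 \<or> card (ends G e) = 2"

definition edges_within :: "('v, 'e) graph \<Rightarrow> 'v set \<Rightarrow> 'e set" where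
  "edges_within G S = {e \<in> edges G. ends G e \<subseteq> S}"

definition induced_subgraph :: "('v, 'e) graph \<Rightarrow> 'v set \<Rightarrow> ('v, 'e) graph" where
  "induced_subgraph G S = G\<lparr>verts := verts G \<inter> S, edges := edges_within G S\<rparr>"

definition delete_verts :: "('v, 'e) graph \<Rightarrow> 'v set \<Rightarrow> ('v, 'e) graph" where
  "delete_verts G F = induced_subgraph G (verts G - F)"

definition spanning_subgraph :: "('v, 'e) graph \<Rightarrow> 'e set \<Rightarrow> ('v, 'e) graph" where
  "spanning_subgraph G X = G\<lparr>edges := X\<rparr>"

definition adjacent :: "('v, 'e) graph \<Rightarrow> 'v \<Rightarrow> 'v \<Rightarrow> bool" where
  "adjacent G u v \<longleftrightarrow> (\<exists>e \<in> edges G. ends G e = {u, v})"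

definition connected_components :: "('v, 'e) graph \<Rightarrow> ('v, 'e) graph set" where
  "connected_components G =
     {induced_subgraph G {w. (adjacent G)\<^sup>*\<^sup>* v w} | v. v \<in> verts G}"

text \<open>
  A cycle is a closed walk of positive length without repeated vertices or edges, identified with
  its edge set (so that rotations and reversals are not counted as different cycles).  Length 1 is a
  loop; length 2 is a pair of distinct parallel edges.
\<close>

definition cycles :: "('v, 'e) graph \<Rightarrow> 'e set set" where
  "cycles G = {set es | vs es.
     es \<noteq> [] \<and> length vs = length es \<and> distinct vs \<and> distinct es \<and>
     set vs \<subseteq> verts G \<and> set es \<subseteq> edges G \<and>
     (\<forall>i < length es. ends G (es ! i) = {vs ! i, vs ! (Suc i mod length es)})}"

text \<open>Meaningful only for graphs with at least one vertex.\<close>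

definition max_density :: "('v, 'e) graph \<Rightarrow> real" where
  "max_density G =
     Max {real (card (edges_within G S)) / real (card S) | S. S \<noteq> {} \<and> S \<subseteq> verts G}"

section \<open>The pseudoforest matroid and matroid unions\<close>

text \<open>A matroid is represented by its ground set together with its family of independent sets.\<close>

type_synonym 'e set_system = "'e set \<times> 'e set set"

definition pseudoforest_matroid :: "('v, 'e) graph \<Rightarrow> 'e set_system" where
  "pseudoforest_matroid G =
     (edges G,
      {X. X \<subseteq> edges G \<and>
          (\<forall>C \<in> connected_components (spanning_subgraph G X). \<exists>\<^sub>\<le>\<^sub>1 Z. Z \<in> cycles C)})"

definition fold_union :: "nat \<Rightarrow> 'e set_system \<Rightarrow> 'e set_system" where
  "fold_union \<rho> M =
     (fst M,
      {A. A \<subseteq> fst M \<and>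
          (\<exists>P :: nat \<Rightarrow> 'e set. (\<Union>i<\<rho>. P i) = A \<and> disjoint_family_on P {..<\<rho>} \<and>
             (\<forall>i<\<rho>. P i \<in> snd M))})"

end

theory Submission
  imports Defs
begin

text \<open>
  A graph with at least as many edges as vertices contains a cycle. Hence a component with more
  edges than vertices contains two: find one, delete one of its edges, find another. So a
  pseudoforest has at most \<open>|S|\<close> edges within every vertex set \<open>S\<close>, which bounds the density.
  Conversely, Hall's theorem turns the density bound into an injective assignment of every edge to a
  pair (end vertex, colour) with \<open>\<rho>\<close> colours. Each colour class is then oriented with out-degree at
  most one, and following the out-edges shows that each of its components has at most one cycle.
\<close>

section \<open>Hall's theorem\<close>

text \<open>
  Rado's argument: if neither \<open>x\<close> nor \<open>y\<close> can be removed from some \<open>A i\<close>, then the two violating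
  index sets contradict the submodularity of the cardinality of unions.
\<close>

lemma hall_marriage:
  fixes A :: "'i \<Rightarrow> 'a set"
  assumes "finite I" and "\<And>i. i \<in> I \<Longrightarrow> finite (A i)"
    and "\<And>J. J \<subseteq> I \<Longrightarrow> card J \<le> card (\<Union>i\<in>J. A i)"
  shows "\<exists>f. inj_on f I \<and> (\<forall>i\<in>I. f i \<in> A i)"
  using assms(2,3)
proof (induction "\<Sum>i\<in>I. card (A i)" arbitrary: A rule: less_induct)
  case less
  show ?case
  proof (cases "\<exists>i\<in>I. \<exists>x y. x \<in> A i \<and> y \<in> A i \<and> x \<noteq> y")
    case False
    have ne: "A i \<noteq> {}" if "i \<in> I" for i
      using less.prems(2)[of "{i}"] that by auto
    define f where "f i = (SOME x. x \<in> A i)" for i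
    have f: "f i \<in> A i" if "i \<in> I" for i
      unfolding f_def using ne[OF that] by (simp add: some_in_eq)
    have Af: "A i = {f i}" if "i \<in> I" for i
      using False f that by blast
    \<comment> \<open>All \<open>A i\<close> are singletons here, so Hall's condition on a pair of
      indices separates their elements.\<close>
    have "inj_on f I"
    proof (rule inj_onI, rule ccontr)
      fix i j assume ij: "i \<in> I" "j \<in> I" "f i = f j" "i \<noteq> j"
      have "card {i, j} \<le> card (\<Union>k\<in>{i, j}. A k)"
        using ij less.prems(2)[of "{i, j}"] by blast
      moreover have "(\<Union>k\<in>{i, j}. A k) = {f i}"
        using Af ij by auto
      ultimately show False using ij by simp
    qed
    with f show ?thesis by blast
  next
    case True
    then obtain i x y where i: "i \<in> I" and xy: "x \<in> A i" "y \<in> A i" "x \<noteq> y" by blast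
    define B where "B z = A(i := A i - {z})" for z
    \<comment> \<open>Deleting \<open>z\<close> lowers the sum of the cardinalities. If Hall's
      condition survives, the induction hypothesis gives a choice for the smaller sets, which also
      serves \<open>A\<close>.\<close>
    have removable: "?thesis"
      if z: "z \<in> A i" and hall: "\<And>J. J \<subseteq> I \<Longrightarrow> card J \<le> card (\<Union>j\<in>J. B z j)" for z
    proof -
      have sub: "B z j \<subseteq> A j" for j by (auto simp: B_def)
      have fin: "finite (B z j)" if "j \<in> I" for j
        using sub less.prems(1)[OF that] by (rule finite_subset)
      have "(\<Sum>j\<in>I. card (B z j)) < (\<Sum>j\<in>I. card (A j))"
      proof (rule sum_strict_mono_ex1)
        show "\<forall>j\<in>I. card (B z j) \<le> card (A j)"
          using sub less.prems(1) by (meson card_mono)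
        have "card (B z i) < card (A i)"
          using z less.prems(1)[OF i] by (simp add: B_def card_Diff1_less del: card_Diff_insert)
        then show "\<exists>j\<in>I. card (B z j) < card (A j)" using i by blast
      qed (use assms(1) in simp)
      from less.hyps[OF this fin hall] sub show ?thesis by blast
    qed
    show ?thesis
    proof (rule ccontr)
      assume no: "\<not> ?thesis"
      \<comment> \<open>Only \<open>A i\<close> was shrunk, so a violating index set contains
        \<open>i\<close>. Splitting \<open>i\<close> off turns its strict inequality into a weak one
        for the remaining indices.\<close>
      have viol: "\<exists>J. J \<subseteq> I - {i} \<and> card ((\<Union>j\<in>J. A j) \<union> (A i - {z})) \<le> card J"
        if z: "z \<in> A i" for z
      proof -
        obtain J where J: "J \<subseteq> I" "card (\<Union>j\<in>J. B z j) < card J"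
          using removable[OF z] no by (meson not_le_imp_less)
        have iJ: "i \<in> J"
        proof (rule ccontr)
          assume "i \<notin> J"
          then have "(\<Union>j\<in>J. B z j) = (\<Union>j\<in>J. A j)" by (auto simp: B_def)
          with J less.prems(2)[OF J(1)] show False by simp
        qed
        have "(\<Union>j\<in>J. B z j) = (\<Union>j\<in>J - {i}. A j) \<union> (A i - {z})"
          using iJ by (auto simp: B_def split: if_splits)
        moreover have "card J = Suc (card (J - {i}))"
          using iJ J(1) assms(1) by (meson card.remove finite_subset)
        ultimately show ?thesis
          using J by (intro exI[of _ "J - {i}"]) auto
      qed
      obtain J where J: "J \<subseteq> I - {i}" "card ((\<Union>j\<in>J. A j) \<union> (A i - {x})) \<le> card J"
        using viol[OF xy(1)] by blast
      obtain K where K: "K \<subseteq> I - {i}" "card ((\<Union>j\<in>K. A j) \<union> (A i - {y})) \<le> card K"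
        using viol[OF xy(2)] by blast
      let ?P = "(\<Union>j\<in>J. A j) \<union> (A i - {x})" and ?Q = "(\<Union>j\<in>K. A j) \<union> (A i - {y})"
      have finJK: "finite J" "finite K"
        using J K assms(1) by (meson finite_Diff finite_subset)+
      have finPQ: "finite ?P" "finite ?Q"
        using finJK J K i less.prems(1) by auto
      have "card (insert i (J \<union> K)) \<le> card (\<Union>j\<in>insert i (J \<union> K). A j)"
        using J K i by (intro less.prems(2)) auto
      \<comment> \<open>As \<open>x\<close> and \<open>y\<close> differ, \<open>A i - {x}\<close>
        and \<open>A i - {y}\<close> together give back \<open>A i\<close>.\<close>
      moreover have "(\<Union>j\<in>insert i (J \<union> K). A j) = ?P \<union> ?Q"
        using xy by auto
      moreover have "card (insert i (J \<union> K)) = Suc (card (J \<union> K))"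
        using finJK J K by (subst card_insert_disjoint) auto
      ultimately have un: "Suc (card (J \<union> K)) \<le> card (?P \<union> ?Q)" by simp
      have "card (J \<inter> K) \<le> card (\<Union>j\<in>J \<inter> K. A j)"
        using J K by (intro less.prems(2)) auto
      also have "\<dots> \<le> card (?P \<inter> ?Q)"
        using finPQ by (intro card_mono) auto
      finally have int: "card (J \<inter> K) \<le> card (?P \<inter> ?Q)" .
      have "card ?P + card ?Q = card (?P \<union> ?Q) + card (?P \<inter> ?Q)"
        by (rule card_Un_Int[OF finPQ])
      moreover have "card J + card K = card (J \<union> K) + card (J \<inter> K)"
        by (rule card_Un_Int[OF finJK])
      ultimately show False using un int J(2) K(2) by linarith
    qed
  qed
qed

section \<open>Subgraphs, components and cycles\<close>

lemma induced_subgraph_simps [simp]: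
  "verts (induced_subgraph G S) = verts G \<inter> S"
  "edges (induced_subgraph G S) = edges_within G S"
  "ends (induced_subgraph G S) = ends G"
  by (simp_all add: induced_subgraph_def)

lemma spanning_subgraph_simps [simp]:
  "verts (spanning_subgraph G X) = verts G"
  "edges (spanning_subgraph G X) = X"
  "ends (spanning_subgraph G X) = ends G"
  by (simp_all add: spanning_subgraph_def)

lemma edges_within_subset: "edges_within G S \<subseteq> edges G"
  by (auto simp: edges_within_def)

lemma fin_graph_subgraph:
  assumes "fin_graph G" and "verts H \<subseteq> verts G" and "edges H \<subseteq> edges G" and "ends H = ends G"
    and "\<And>e. e \<in> edges H \<Longrightarrow> ends G e \<subseteq> verts H"
  shows "fin_graph H"
proof -
  interpret fin_graph G by fact
  show ?thesis
  proof
    show "finite (verts H)" "finite (edges H)"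
      using assms(2,3) finite_verts finite_edges by (auto intro: finite_subset)
    show "ends H e \<subseteq> verts H" "card (ends H e) = 1 \<or> card (ends H e) = 2" if "e \<in> edges H" for e
      using that assms(3-5) card_ends[of e] by auto
  qed
qed

lemma fin_graph_induced_subgraph: "fin_graph G \<Longrightarrow> fin_graph (induced_subgraph G S)"
  by (rule fin_graph_subgraph) (auto simp: edges_within_def dest: fin_graph.ends_in_verts)

lemma fin_graph_spanning_subgraph:
  "fin_graph G \<Longrightarrow> X \<subseteq> edges G \<Longrightarrow> fin_graph (spanning_subgraph G X)"
  by (rule fin_graph_subgraph) (auto dest: fin_graph.ends_in_verts)

lemma cycles_mono:
  assumes "verts H \<subseteq> verts G" and "edges H \<subseteq> edges G" and "ends H = ends G"
  shows "cycles H \<subseteq> cycles G"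
  using assms unfolding cycles_def by (smt (verit) Collect_mono subset_trans)

lemma cycles_nonempty_subset: "Z \<in> cycles G \<Longrightarrow> Z \<noteq> {} \<and> Z \<subseteq> edges G"
  by (auto simp: cycles_def)

lemma adjacent_mono:
  assumes "edges H \<subseteq> edges G" and "ends H = ends G"
  shows "(adjacent H)\<^sup>*\<^sup>* v w \<Longrightarrow> (adjacent G)\<^sup>*\<^sup>* v w"
proof (erule rtranclp_mono[THEN predicate2D, rotated], rule predicate2I)
  show "adjacent G x y" if "adjacent H x y" for x y
    using that assms unfolding adjacent_def by (metis subsetD)
qed

text \<open>Vertices reachable in \<open>H\<close> stay reachable in \<open>G\<close>, so the
  component of the same start vertex in \<open>G\<close> can serve as \<open>D\<close>. This
  transfers two cycles in one component to a larger graph.\<close>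

lemma connected_components_mono:
  assumes "verts H \<subseteq> verts G" and "edges H \<subseteq> edges G" and "ends H = ends G"
    and "C \<in> connected_components H"
  shows "\<exists>D\<in>connected_components G. cycles C \<subseteq> cycles D"
proof -
  let ?R = "\<lambda>G v. {w. (adjacent G)\<^sup>*\<^sup>* v w}"
  obtain v where v: "v \<in> verts H" "C = induced_subgraph H (?R H v)"
    using assms(4) by (auto simp: connected_components_def)
  have "?R H v \<subseteq> ?R G v"
    using adjacent_mono[OF assms(2,3)] by blast
  then have "cycles C \<subseteq> cycles (induced_subgraph G (?R G v))"
    unfolding v(2) using assms by (intro cycles_mono) (auto simp: edges_within_def)
  with v assms(1) show ?thesis
    unfolding connected_components_def by blast
qed

section \<open>Cycles forced by counting edges against vertices\<close>

context fin_graph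
begin

lemma other_end:
  assumes "e \<in> edges G" and "v \<in> ends G e"
  obtains w where "ends G e = {v, w}"
  using card_ends[OF assms(1)] assms(2)
  by (auto simp: card_1_singleton_iff card_2_iff doubleton_eq_iff)

text \<open>
  The walk below never uses an edge twice in a row, so the segment up to its first repeated vertex
  is a cycle.
\<close>

lemma cycle_if_min_degree_two:
  assumes ne: "verts G \<noteq> {}"
    and deg: "\<And>v. v \<in> verts G \<Longrightarrow> 1 < card {e \<in> edges G. v \<in> ends G e}"
  shows "cycles G \<noteq> {}"
proof -
  \<comment> \<open>A state pairs the current vertex with the edge by which it was entered,
    initially any incident edge. \<open>?Q\<close> makes the walk leave along a different edge,
    which the degree bound provides.\<close>
  let ?P = "\<lambda>n::nat. \<lambda>(v, e). e \<in> edges G \<and> v \<in> ends G e"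
  let ?Q = "\<lambda>n::nat. \<lambda>(v, e) (v', e'). ends G e' = {v, v'} \<and> e' \<noteq> e"
  have "\<exists>p. \<forall>n. ?P n (p n) \<and> ?Q n (p n) (p (Suc n))"
  proof (rule dependent_nat_choice[where P = ?P and Q = ?Q])
    obtain v where "v \<in> verts G" using ne by blast
    then have "{e \<in> edges G. v \<in> ends G e} \<noteq> {}"
      using deg[of v] by (metis card.empty not_less_zero)
    then show "\<exists>p. ?P 0 p" by auto
  next
    fix p and n :: nat assume "?P n p"
    then obtain v e where p: "p = (v, e)" "e \<in> edges G" "v \<in> ends G e" by (cases p) auto
    have "\<not> {e' \<in> edges G. v \<in> ends G e'} \<subseteq> {e}"
    proof
      assume "{e' \<in> edges G. v \<in> ends G e'} \<subseteq> {e}"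
      then have "card {e' \<in> edges G. v \<in> ends G e'} \<le> card {e}" by (intro card_mono) auto
      then show False using deg[of v] p ends_in_verts by fastforce
    qed
    then obtain e' where e': "e' \<in> edges G" "v \<in> ends G e'" "e' \<noteq> e" by auto
    obtain w where "ends G e' = {v, w}" using other_end[OF e'(1,2)] .
    with e' p show "\<exists>p'. ?P (Suc n) p' \<and> ?Q n p p'"
      by (intro exI[of _ "(w, e')"]) auto
  qed
  then obtain p where "\<forall>n. ?P n (p n) \<and> ?Q n (p n) (p (Suc n))" by (rule exE)
  then have p: "?P n (p n)" "?Q n (p n) (p (Suc n))" for n by simp_all
  define w where "w n = fst (p n)" for n
  \<comment> \<open>A state stores its entering edge, hence the shift: \<open>f n\<close> joins
    \<open>w n\<close> to \<open>w (Suc n)\<close>.\<close>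
  define f where "f n = snd (p (Suc n))" for n
  have fE: "f n \<in> edges G" for n
    using p(1)[of "Suc n"] by (auto simp: f_def split: prod.splits)
  have fends: "ends G (f n) = {w n, w (Suc n)}" for n
    using p(2)[of n] by (auto simp: f_def w_def split: prod.splits)
  have fneq: "f (Suc n) \<noteq> f n" for n
    using p(2)[of "Suc n"] by (auto simp: f_def split: prod.splits)
  have wV: "w n \<in> verts G" for n
    using fends[of n] fE[of n] ends_in_verts by blast
  have "\<not> inj w"
    using wV finite_verts by (meson finite_imageD finite_subset image_subsetI infinite_UNIV_nat)
  then have "\<exists>j. \<exists>i<j. w i = w j"
    by (metis injI linorder_neqE_nat)
  \<comment> \<open>The least such \<open>j\<close> is the first repetition, so all earlier vertices
    of the walk are distinct.\<close>
  then obtain j where j: "\<exists>i<j. w i = w j" and min: "\<And>j'. j' < j \<Longrightarrow> \<not> (\<exists>i<j'. w i = w j')"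
    using exists_least_iff[of "\<lambda>j. \<exists>i<j. w i = w j"] by blast
  from j obtain i where i: "i < j" "w i = w j" by blast
  have winj: "a = b" if "w a = w b" "a < j" "b < j" for a b
    using min that by (metis linorder_neqE_nat)
  \<comment> \<open>Equal edges have equal ends, and \<open>w a\<close> differs from
    \<open>w b\<close>, so \<open>w b\<close> is \<open>w (Suc a)\<close> and \<open>b\<close> is
    \<open>Suc a\<close>. But consecutive edges differ.\<close>
  have finj: "a = b" if "f a = f b" "a < b" "b < j" for a b
  proof -
    have eq: "{w a, w (Suc a)} = {w b, w (Suc b)}" using fends that by metis
    have "w a \<noteq> w b" using winj that by fastforce
    with eq have "w b = w (Suc a)" by (auto simp: doubleton_eq_iff)
    then have "b = Suc a" using that by (intro winj) auto
    then show ?thesis using fneq that by metis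
  qed
  define vs where "vs = map w [i..<j]"
  define es where "es = map f [i..<j]"
  have "set es \<in> cycles G"
    unfolding cycles_def
  proof (intro CollectI exI conjI)
    show "es \<noteq> []" "length vs = length es" using i by (auto simp: es_def vs_def)
    show "distinct vs"
      using winj by (auto simp: vs_def distinct_map intro!: inj_onI)
    show "distinct es"
      using finj by (auto simp: es_def distinct_map intro!: inj_onI) (metis linorder_neqE_nat)
    show "set vs \<subseteq> verts G" "set es \<subseteq> edges G" using wV fE by (auto simp: vs_def es_def)
    show "\<forall>k<length es. ends G (es ! k) = {vs ! k, vs ! (Suc k mod length es)}"
    proof (intro allI impI)
      fix k assume "k < length es"
      then have k: "k < j - i" by (simp add: es_def)
      show "ends G (es ! k) = {vs ! k, vs ! (Suc k mod length es)}"
      proof (cases "Suc k = j - i")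
        case True
        \<comment> \<open>The last edge closes the cycle because \<open>w j = w i\<close>.\<close>
        then have "Suc (i + k) = j" using i by simp
        then show ?thesis using True k i fends[of "i + k"] by (simp add: es_def vs_def)
      next
        case False
        then show ?thesis using k i fends[of "i + k"] by (simp add: es_def vs_def)
      qed
    qed
  qed simp
  then show ?thesis by blast
qed

lemma loop_cycle:
  assumes "e \<in> edges G" and "ends G e = {v}"
  shows "{e} \<in> cycles G"
  unfolding cycles_def using assms ends_in_verts[OF assms(1)]
  by (intro CollectI exI[of _ "[v]"] exI[of _ "[e]"]) auto

end

text \<open>Deleting a vertex that lies on at most one edge preserves the inequality, so induction
  applies. Without such a vertex, \<open>cycle_if_min_degree_two\<close> does.\<close>

lemma cycle_if_card_verts_le_card_edges:
  assumes "fin_graph G" and "verts G \<noteq> {}" and "card (verts G) \<le> card (edges G)"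
  shows "cycles G \<noteq> {}"
  using assms
proof (induction "card (verts G)" arbitrary: G rule: less_induct)
  case less
  interpret fin_graph G by fact
  show ?case
  proof (cases "\<forall>v\<in>verts G. 1 < card {e \<in> edges G. v \<in> ends G e}")
    case True
    then show ?thesis using cycle_if_min_degree_two less.prems by blast
  next
    case False
    then obtain v where v: "v \<in> verts G" and deg: "card {e \<in> edges G. v \<in> ends G e} \<le> 1"
      by fastforce
    let ?H = "induced_subgraph G (verts G - {v})"
    have split: "edges G = edges ?H \<union> {e \<in> edges G. v \<in> ends G e}"
      using ends_in_verts by (auto simp: edges_within_def)
    have "card (edges G) \<le> card (edges ?H) + card {e \<in> edges G. v \<in> ends G e}"
      by (subst split) (rule card_Un_le)
    moreover have "verts ?H = verts G - {v}" by auto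
    moreover have "card (verts G) = Suc (card (verts G - {v}))"
      using v finite_verts by (meson card.remove)
    ultimately have card: "card (verts ?H) < card (verts G)" "card (verts ?H) \<le> card (edges ?H)"
      using deg less.prems by auto
    show ?thesis
    proof (cases "verts ?H = {}")
      case True
      \<comment> \<open>The induction hypothesis needs a remaining vertex. If there is none, every
        edge is a loop at \<open>v\<close>.\<close>
      then have V: "verts G = {v}" using v by auto
      with less.prems have "edges G \<noteq> {}" by auto
      then obtain e where e: "e \<in> edges G" by blast
      have "ends G e = {v}"
        using ends_in_verts[OF e] card_ends[OF e] V by (auto simp: subset_singleton_iff)
      then show ?thesis using loop_cycle e by blast
    next
      case False
      then have "cycles ?H \<noteq> {}"
        using less.hyps card fin_graph_induced_subgraph less.prems(1) by blast
      moreover have "cycles ?H \<subseteq> cycles G"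
        by (rule cycles_mono) (auto simp: edges_within_def)
      ultimately show ?thesis by blast
    qed
  qed
qed

lemma two_cycles_if_card_verts_less_card_edges:
  assumes "fin_graph G" and "verts G \<noteq> {}" and "card (verts G) < card (edges G)"
  shows "\<exists>Z\<in>cycles G. \<exists>Z'\<in>cycles G. Z \<noteq> Z'"
proof -
  interpret fin_graph G by fact
  obtain Z where Z: "Z \<in> cycles G"
    using cycle_if_card_verts_le_card_edges assms by fastforce
  then obtain e where e: "e \<in> Z" "e \<in> edges G" using cycles_nonempty_subset by blast
  \<comment> \<open>The strict inequality leaves a weak one after deleting \<open>e\<close>, and a
    cycle avoiding \<open>e\<close> differs from \<open>Z\<close>.\<close>
  let ?H = "spanning_subgraph G (edges G - {e})"
  have "card (verts ?H) \<le> card (edges ?H)"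
    using assms(3) e finite_edges by simp
  then obtain Z' where Z': "Z' \<in> cycles ?H"
    using cycle_if_card_verts_le_card_edges[of ?H] fin_graph_spanning_subgraph assms(1,2) by fastforce
  then have "e \<notin> Z'" using cycles_nonempty_subset by fastforce
  moreover have "Z' \<in> cycles G" using Z' cycles_mono[of ?H G] by auto
  ultimately show ?thesis using Z e by blast
qed

text \<open>Induction splits off one component. Either it has more edges than vertices itself, or
  the rest of the graph keeps the excess of edges.\<close>

lemma component_two_cycles_if_card_verts_less_card_edges:
  assumes "fin_graph G" and "card (verts G) < card (edges G)"
  shows "\<exists>C\<in>connected_components G. \<exists>Z\<in>cycles C. \<exists>Z'\<in>cycles C. Z \<noteq> Z'"
  using assms
proof (induction "card (verts G)" arbitrary: G rule: less_induct)
  case less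
  interpret fin_graph G by fact
  have "edges G \<noteq> {}" using less.prems by auto
  then obtain e where e: "e \<in> edges G" by blast
  then have "ends G e \<noteq> {}" using card_ends by fastforce
  then obtain v where v: "v \<in> verts G" using ends_in_verts[OF e] by blast
  let ?R = "{w. (adjacent G)\<^sup>*\<^sup>* v w}"
  let ?C = "induced_subgraph G ?R" and ?D = "induced_subgraph G (verts G - ?R)"
  have C: "?C \<in> connected_components G" using v by (auto simp: connected_components_def)
  have finC: "fin_graph ?C" and finD: "fin_graph ?D"
    using less.prems(1) by (simp_all only: fin_graph_induced_subgraph)
  have vC: "v \<in> verts ?C" using v by simp
  show ?case
  proof (cases "card (verts ?C) < card (edges ?C)")
    case True
    then show ?thesis
      using two_cycles_if_card_verts_less_card_edges[OF finC] C vC by blast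
  next
    case False
    have closed: "ends G e \<subseteq> ?R" if e: "e \<in> edges G" and x: "x \<in> ends G e" "x \<in> ?R" for e x
    proof -
      obtain y where y: "ends G e = {x, y}" using other_end[OF e x(1)] .
      then have "adjacent G x y" using e by (auto simp: adjacent_def)
      then have "y \<in> ?R" using x(2) by (auto intro: rtranclp.rtrancl_into_rtrancl)
      then show ?thesis using x y by simp
    qed
    have "edges G \<subseteq> edges ?C \<union> edges ?D"
    proof
      fix e assume e: "e \<in> edges G"
      show "e \<in> edges ?C \<union> edges ?D"
        using e closed[OF e] ends_in_verts[OF e]
        by (cases "ends G e \<inter> ?R = {}") (auto simp: edges_within_def)
    qed
    moreover have "finite (edges ?C)" "finite (edges ?D)"
      using finC finD fin_graph.finite_edges by blast+
    ultimately have "card (edges G) \<le> card (edges ?C) + card (edges ?D)"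
      by (meson card_Un_le card_mono finite_UnI le_trans)
    moreover have "card (verts G) = card (verts ?C) + card (verts ?D)"
    proof -
      have "verts G = verts ?C \<union> verts ?D" "verts ?C \<inter> verts ?D = {}" by auto
      then show ?thesis using finite_verts by (metis card_Un_disjoint finite_Un)
    qed
    moreover have "0 < card (verts ?C)"
      using vC fin_graph.finite_verts[OF finC] by (auto simp: card_gt_0_iff)
    ultimately have "card (verts ?D) < card (verts G)" "card (verts ?D) < card (edges ?D)"
      using False less.prems(2) by linarith+
    from less.hyps[OF this(1) finD this(2)]
    obtain K where K: "K \<in> connected_components ?D" "\<exists>Z\<in>cycles K. \<exists>Z'\<in>cycles K. Z \<noteq> Z'"
      by blast
    have "\<exists>K'\<in>connected_components G. cycles K \<subseteq> cycles K'"
      by (rule connected_components_mono[OF _ _ _ K(1)]) (auto simp: edges_within_def)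
    with K(2) show ?thesis by blast
  qed
qed

section \<open>Pseudoforests\<close>

text \<open>An excess of edges would put two cycles into one component of the graph on
  \<open>S\<close> with the edges of \<open>X\<close> inside \<open>S\<close>, hence into one
  component of the graph with edge set \<open>X\<close>.\<close>

lemma pseudoforest_sparse:
  assumes "fin_graph G" and "X \<in> snd (pseudoforest_matroid G)"
    and "S \<subseteq> verts G"
  shows "card (X \<inter> edges_within G S) \<le> card S"
proof (rule ccontr)
  assume gr: "\<not> ?thesis"
  have X: "X \<subseteq> edges G"
    and uniq: "\<And>C. C \<in> connected_components (spanning_subgraph G X) \<Longrightarrow> \<exists>\<^sub>\<le>\<^sub>1 Z. Z \<in> cycles C"
    using assms(2) by (auto simp: pseudoforest_matroid_def)
  let ?G = "spanning_subgraph G X"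
  let ?H = "induced_subgraph ?G S"
  have "verts ?H = S" "edges ?H = X \<inter> edges_within G S"
    using assms(3) X by (auto simp: edges_within_def)
  moreover have "fin_graph ?H"
    using assms(1) X by (intro fin_graph_induced_subgraph fin_graph_spanning_subgraph)
  ultimately obtain C where C: "C \<in> connected_components ?H"
      "\<exists>Z\<in>cycles C. \<exists>Z'\<in>cycles C. Z \<noteq> Z'"
    using component_two_cycles_if_card_verts_less_card_edges[of ?H] gr by auto
  have "\<exists>D\<in>connected_components ?G. cycles C \<subseteq> cycles D"
    by (rule connected_components_mono[OF _ _ _ C(1)]) (auto simp: edges_within_def)
  with C(2) uniq show False unfolding Uniq_def by blast
qed

text \<open>
  If \<open>h\<close> maps every edge injectively to one of its ends, then a vertex of a cycle is the image of
  an edge of that cycle, so a cycle can never be left along out-edges.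
\<close>

lemma pseudoforest_if_injective_end:
  assumes "fin_graph G" and X: "X \<subseteq> edges G" and inj: "inj_on h X"
    and h: "\<And>e. e \<in> X \<Longrightarrow> h e \<in> ends G e"
  shows "X \<in> snd (pseudoforest_matroid G)"
proof -
  interpret fin_graph G by fact
  define closed where "closed W Z \<longleftrightarrow> Z \<subseteq> X \<and> h ` Z = W \<and> (\<forall>e\<in>Z. ends G e \<subseteq> W)" for W Z
  \<comment> \<open>Every vertex of \<open>W\<close> is already the image of an edge of
    \<open>Z\<close>, so injectivity forces \<open>e\<close> into \<open>Z\<close>.\<close>
  have closedD: "e \<in> Z \<and> ends G e \<subseteq> W" if "closed W Z" "e \<in> X" "h e \<in> W" for W Z e
    using that inj unfolding closed_def by (metis imageE inj_onD subsetD)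
  have cyc: "closed (set vs) (set es)"
    \<comment> \<open>Following out-edges from any vertex of a cycle runs through the whole cycle.
      Counting positions proves this without deciding in which direction \<open>h\<close> orients
      the cycle.\<close>
    and conn: "\<And>U. U \<inter> set vs \<noteq> {} \<Longrightarrow>
      (\<And>e. e \<in> set es \<Longrightarrow> h e \<in> U \<Longrightarrow> ends G e \<subseteq> U) \<Longrightarrow> set vs \<subseteq> U"
    if c: "es \<noteq> []" "length vs = length es" "distinct vs" "distinct es" "set es \<subseteq> X"
      "\<forall>i<length es. ends G (es ! i) = {vs ! i, vs ! (Suc i mod length es)}" for vs es
  proof -
    let ?n = "length es"
    have ends_vs: "ends G e \<subseteq> set vs" if e: "e \<in> set es" for e
    proof -
      obtain i where i: "i < ?n" "e = es ! i" using e by (auto simp: in_set_conv_nth)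
      then have "Suc i mod ?n < ?n" using c(1) by simp
      with i c(2,6) show ?thesis by simp
    qed
    have sub: "h ` set es \<subseteq> set vs" using ends_vs h c(5) by blast
    have inj': "inj_on h (set es)" using inj c(5) inj_on_subset by blast
    \<comment> \<open>A cycle has as many edges as vertices, so the injection is onto.\<close>
    have him: "h ` set es = set vs"
      using sub inj' c(2-4) by (intro card_subset_eq) (auto simp: card_image distinct_card)
    with ends_vs c(5) show "closed (set vs) (set es)" by (simp add: closed_def)
    fix U assume ne: "U \<inter> set vs \<noteq> {}"
      and U: "\<And>e. e \<in> set es \<Longrightarrow> h e \<in> U \<Longrightarrow> ends G e \<subseteq> U"
    define I where "I = {i. i < ?n \<and> h (es ! i) \<in> U}"
    define J where "J = {i. i < ?n \<and> vs ! i \<in> U}"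
    have IJ: "I \<subseteq> J" using U c(6) by (force simp: I_def J_def)
    have preim: "card {i. i < ?n \<and> g i \<in> U} = card (U \<inter> set vs)"
      if g: "bij_betw g {..<?n} (set vs)" for g
    proof -
      have "g ` {i. i < ?n \<and> g i \<in> U} = U \<inter> set vs"
        using bij_betw_imp_surj_on[OF g] by auto
      moreover have "inj_on g {i. i < ?n \<and> g i \<in> U}"
        using bij_betw_imp_inj_on[OF g] by (rule inj_on_subset) auto
      ultimately show ?thesis by (metis card_image)
    qed
    have "bij_betw (\<lambda>i. h (es ! i)) {..<?n} (set vs)"
      using bij_betw_trans[OF bij_betw_nth[OF c(4) refl refl], of h "set vs"] inj' him
      by (simp add: bij_betw_def comp_def)
    then have "card I = card (U \<inter> set vs)" unfolding I_def by (rule preim)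
    moreover have "card J = card (U \<inter> set vs)"
      unfolding J_def by (intro preim bij_betw_nth) (simp_all add: c)
    \<comment> \<open>Both sets have the size of \<open>U \<inter> set vs\<close>. Hence an edge
      listed at a vertex of \<open>U\<close> also has its image in \<open>U\<close>, which puts the
      next vertex into \<open>U\<close>.\<close>
    ultimately have eq: "I = J"
      using IJ by (intro card_subset_eq) (auto simp: J_def)
    have step: "vs ! (Suc i mod ?n) \<in> U" if "i < ?n" "vs ! i \<in> U" for i
    proof -
      have "i \<in> I" using eq that by (simp add: J_def)
      then have "ends G (es ! i) \<subseteq> U" using U by (simp add: I_def)
      then show ?thesis using c(6) that by simp
    qed
    obtain i where i: "i < ?n" "vs ! i \<in> U" using ne c(2) by (auto simp: in_set_conv_nth)
    have all: "vs ! ((i + k) mod ?n) \<in> U" for k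
    proof (induction k)
      case 0
      then show ?case using i by simp
    next
      case (Suc k)
      have "(i + k) mod ?n < ?n" using c(1) by simp
      from step[OF this Suc] show ?case by (simp add: mod_Suc_eq)
    qed
    show "set vs \<subseteq> U"
    proof
      fix v assume "v \<in> set vs"
      then obtain j where j: "j < ?n" "v = vs ! j" using c(2) by (auto simp: in_set_conv_nth)
      have "(i + (?n - i + j)) mod ?n = j" using i j by simp
      then show "v \<in> U" using all[of "?n - i + j"] j by simp
    qed
  qed
  let ?G = "spanning_subgraph G X"
  have uniq: "Z = Z'"
    if Z: "Z \<in> cycles (induced_subgraph ?G {w. (adjacent ?G)\<^sup>*\<^sup>* r w})"
      and Z': "Z' \<in> cycles (induced_subgraph ?G {w. (adjacent ?G)\<^sup>*\<^sup>* r w})" for Z Z' r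
  proof -
    obtain vs es where c: "Z = set es" "es \<noteq> []" "length vs = length es" "distinct vs"
        "distinct es" "set es \<subseteq> X"
        "\<forall>i<length es. ends G (es ! i) = {vs ! i, vs ! (Suc i mod length es)}"
      and reach: "\<And>v. v \<in> set vs \<Longrightarrow> (adjacent ?G)\<^sup>*\<^sup>* r v"
      using Z unfolding cycles_def by (auto simp: edges_within_def subset_iff)
    obtain vs' es' where c': "Z' = set es'" "es' \<noteq> []" "length vs' = length es'" "distinct vs'"
        "distinct es'" "set es' \<subseteq> X"
        "\<forall>i<length es'. ends G (es' ! i) = {vs' ! i, vs' ! (Suc i mod length es')}"
      and reach': "\<And>v. v \<in> set vs' \<Longrightarrow> (adjacent ?G)\<^sup>*\<^sup>* r v"
      using Z' unfolding cycles_def by (auto simp: edges_within_def subset_iff)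
    note cl = cyc[OF c(2-7)] and cl' = cyc[OF c'(2-7)]
    define out where "out w v \<longleftrightarrow> (\<exists>e\<in>X. h e = w \<and> ends G e = {w, v})" for w v
    \<comment> \<open>These are the vertices from which out-edges lead to the first cycle.\<close>
    define D where "D = {w. \<exists>v\<in>set vs. out\<^sup>*\<^sup>* w v}"
    \<comment> \<open>If the edge is assigned to \<open>y\<close>, it prolongs the path at its
      start. If it is assigned to \<open>x\<close>, it is the only out-edge of \<open>x\<close>, so
      \<open>y\<close> is the next vertex of the path, or lies on the cycle when \<open>x\<close>
      does.\<close>
    have stepD: "y \<in> D" if x: "x \<in> D" and xy: "adjacent ?G x y" for x y
    proof -
      obtain e where e: "e \<in> X" "ends G e = {x, y}" using xy by (auto simp: adjacent_def)
      obtain v where v: "v \<in> set vs" "out\<^sup>*\<^sup>* x v" using x by (auto simp: D_def)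
      consider "h e = y" | "h e = x" using h[OF e(1)] e(2) by auto
      then show ?thesis
      proof cases
        case 1
        then have "out y x" using e by (auto simp: out_def)
        then show ?thesis using v by (auto simp: D_def intro: converse_rtranclp_into_rtranclp)
      next
        case 2
        from v(2) show ?thesis
        proof (cases rule: converse_rtranclpE)
          case base
          then have "y \<in> set vs" using closedD[OF cl e(1)] 2 v(1) e(2) by auto
          then show ?thesis by (auto simp: D_def)
        next
          case (step z)
          then obtain e' where e': "e' \<in> X" "h e' = x" "ends G e' = {x, z}" by (auto simp: out_def)
          then have "e' = e" using inj 2 e(1) by (metis inj_onD)
          then have "z = y" using e e' by (auto simp: doubleton_eq_iff)
          then show ?thesis using step v by (auto simp: D_def)
        qed
      qed
    qed
    have sym: "(adjacent ?G)\<^sup>*\<^sup>* y x" if "(adjacent ?G)\<^sup>*\<^sup>* x y" for x y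
      using that by (rule sympD[OF sympI[THEN symp_rtranclp], rotated])
        (auto simp: adjacent_def insert_commute)
    have "set vs \<noteq> {}" "set vs' \<noteq> {}" using c c' by auto
    then obtain x y where x: "x \<in> set vs" and y: "y \<in> set vs'" by (meson ex_in_conv)
    have xy: "(adjacent ?G)\<^sup>*\<^sup>* x y"
      using sym[OF reach[OF x]] reach'[OF y] by (rule rtranclp_trans)
    have "y \<in> D"
      using xy
    proof (induction rule: rtranclp_induct)
      case base
      then show ?case using x by (auto simp: D_def)
    next
      case (step y z)
      then show ?case using stepD by blast
    qed
    then obtain v where v: "v \<in> set vs" "out\<^sup>*\<^sup>* y v" by (auto simp: D_def)
    \<comment> \<open>The path from \<open>y\<close> starts on the second cycle and cannot leave it,
      so its end on the first cycle is common to both.\<close>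
    have "v \<in> set vs'"
      using v(2)
    proof (induction rule: rtranclp_induct)
      case base
      then show ?case by (rule y)
    next
      case (step y z)
      then show ?case using closedD[OF cl'] by (auto simp: out_def)
    qed
    with v(1) have meet: "set vs \<inter> set vs' \<noteq> {}" "set vs' \<inter> set vs \<noteq> {}" by auto
    \<comment> \<open>Each vertex set is closed under out-edges and meets the other cycle, so
      \<open>conn\<close> gives both inclusions. Equal vertex sets mean equal images under
      \<open>h\<close>, hence equal edge sets.\<close>
    have "set vs \<subseteq> set vs'"
      using conn[OF c(2-7) meet(2)] closedD[OF cl'] c(6) by blast
    moreover have "set vs' \<subseteq> set vs"
      using conn[OF c'(2-7) meet(1)] closedD[OF cl] c'(6) by blast
    ultimately have eq: "h ` Z = h ` Z'" using cl cl' c(1) c'(1) by (simp add: closed_def)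
    have "Z \<subseteq> X" "Z' \<subseteq> X" using c c' by simp_all
    with eq inj show "Z = Z'" by (simp add: inj_on_image_eq_iff)
  qed
  then show ?thesis
    using X unfolding pseudoforest_matroid_def connected_components_def Uniq_def by auto
qed

section \<open>Density\<close>

lemma max_density_le_iff:
  assumes "finite (verts G)" and "verts G \<noteq> {}"
  shows "max_density G \<le> r \<longleftrightarrow>
    (\<forall>S. S \<noteq> {} \<and> S \<subseteq> verts G \<longrightarrow> real (card (edges_within G S)) \<le> r * real (card S))"
proof -
  let ?D = "{real (card (edges_within G S)) / real (card S) | S. S \<noteq> {} \<and> S \<subseteq> verts G}"
  have "finite ?D" using assms(1) by (simp add: setcompr_eq_image)
  moreover have "?D \<noteq> {}" using assms(2) by auto
  ultimately have "max_density G \<le> r \<longleftrightarrow> (\<forall>d\<in>?D. d \<le> r)"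
    unfolding max_density_def by (rule Max_le_iff)
  also have "\<dots> \<longleftrightarrow> (\<forall>S. S \<noteq> {} \<and> S \<subseteq> verts G \<longrightarrow>
      real (card (edges_within G S)) / real (card S) \<le> r)" by blast
  also have "\<dots> \<longleftrightarrow>
    (\<forall>S. S \<noteq> {} \<and> S \<subseteq> verts G \<longrightarrow> real (card (edges_within G S)) \<le> r * real (card S))"
  proof -
    have "0 < real (card S)" if "S \<noteq> {}" "S \<subseteq> verts G" for S
      using that assms(1) by (simp add: card_gt_0_iff finite_subset)
    then show ?thesis by (metis pos_divide_le_eq)
  qed
  finally show ?thesis .
qed

text \<open>The right side is free of quotients and of \<open>Max\<close>. With no vertices left it
  holds vacuously, matching the separate disjunct on the left, where \<open>Max\<close> would range
  over the empty set.\<close>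

lemma density_delete_verts_le_iff:
  assumes "finite (verts G)"
  shows "verts (delete_verts G F) = {} \<or> max_density (delete_verts G F) \<le> real \<rho> \<longleftrightarrow>
    (\<forall>S. S \<noteq> {} \<and> S \<subseteq> verts G - F \<longrightarrow> card (edges_within G S) \<le> \<rho> * card S)"
proof -
  have V: "verts (delete_verts G F) = verts G - F" by (auto simp: delete_verts_def)
  have E: "edges_within (delete_verts G F) S = edges_within G S" if "S \<subseteq> verts G - F" for S
    using that by (auto simp: delete_verts_def edges_within_def)
  show ?thesis
  proof (cases "verts G - F = {}")
    case True
    then show ?thesis using V by auto
  next
    case False
    then have "max_density (delete_verts G F) \<le> real \<rho> \<longleftrightarrow>
      (\<forall>S. S \<noteq> {} \<and> S \<subseteq> verts G - F \<longrightarrow>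
        real (card (edges_within (delete_verts G F) S)) \<le> real \<rho> * real (card S))"
      using max_density_le_iff[of "delete_verts G F" "real \<rho>"] assms V by simp
    also have "\<dots> \<longleftrightarrow>
      (\<forall>S. S \<noteq> {} \<and> S \<subseteq> verts G - F \<longrightarrow> card (edges_within G S) \<le> \<rho> * card S)"
      using E by (metis of_nat_le_iff of_nat_mult)
    finally show ?thesis using V False by simp
  qed
qed

section \<open>Partition into pseudoforests and the density bound\<close>

theorem theoremA2:
  fixes G :: "('v, 'e) graph" and \<rho> :: nat and F :: "'v set"
  assumes "fin_graph G" and "\<rho> > 0" and "F \<subseteq> verts G"
  shows "edges_within G (verts G - F) \<in> snd (fold_union \<rho> (pseudoforest_matroid G)) \<longleftrightarrow>
         verts (delete_verts G F) = {} \<or> max_density (delete_verts G F) \<le> real \<rho>"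
proof -
  interpret fin_graph G by fact
  let ?A = "edges_within G (verts G - F)"
  show ?thesis
    unfolding density_delete_verts_le_iff[OF finite_verts]
  proof
    assume "?A \<in> snd (fold_union \<rho> (pseudoforest_matroid G))"
    then obtain P where P: "(\<Union>i<\<rho>. P i) = ?A" "\<And>i. i < \<rho> \<Longrightarrow> P i \<in> snd (pseudoforest_matroid G)"
      by (auto simp: fold_union_def)
    show "\<forall>S. S \<noteq> {} \<and> S \<subseteq> verts G - F \<longrightarrow> card (edges_within G S) \<le> \<rho> * card S"
    proof (intro allI impI, elim conjE)
      fix S assume S: "S \<subseteq> verts G - F"
      have "edges_within G S \<subseteq> ?A" using S by (auto simp: edges_within_def)
      \<comment> \<open>Each of the \<rho> parts contributes at most \<open>card S\<close>
        edges.\<close>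
      then have "edges_within G S = (\<Union>i<\<rho>. P i \<inter> edges_within G S)" using P(1) by blast
      then have "card (edges_within G S) \<le> (\<Sum>i<\<rho>. card (P i \<inter> edges_within G S))"
        by (metis card_UN_le finite_lessThan)
      also have "\<dots> \<le> (\<Sum>i<\<rho>. card S)"
        using S P(2) by (intro sum_mono pseudoforest_sparse[OF assms(1)]) auto
      finally show "card (edges_within G S) \<le> \<rho> * card S" by simp
    qed
  next
    assume dens: "\<forall>S. S \<noteq> {} \<and> S \<subseteq> verts G - F \<longrightarrow> card (edges_within G S) \<le> \<rho> * card S"
    have AE: "?A \<subseteq> edges G" by (rule edges_within_subset)
    have finA: "finite ?A" using AE finite_edges by (rule finite_subset)
    have fin_ends: "finite (ends G e)" if "e \<in> ?A" for e
      using that AE ends_in_verts finite_verts by (meson finite_subset subsetD)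
    \<comment> \<open>The candidates for an edge are its ends paired with colours. For a set
      \<open>J\<close> of edges spanning \<open>?S\<close> they number
      \<open>\<rho> * card ?S\<close>, so Hall's condition is the density bound at
      \<open>?S\<close>.\<close>
    have "\<exists>f. inj_on f ?A \<and> (\<forall>e\<in>?A. f e \<in> ends G e \<times> {..<\<rho>})"
    proof (rule hall_marriage[OF finA])
      fix J assume J: "J \<subseteq> ?A"
      let ?S = "\<Union>e\<in>J. ends G e"
      have S: "?S \<subseteq> verts G - F" using J by (auto simp: edges_within_def)
      show "card J \<le> card (\<Union>e\<in>J. ends G e \<times> {..<\<rho>})"
      proof (cases "J = {}")
        case False
        then obtain e where e: "e \<in> J" by blast
        then have "ends G e \<noteq> {}" using card_ends J AE by fastforce
        with e have "?S \<noteq> {}" by blast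
        then have "card (edges_within G ?S) \<le> \<rho> * card ?S"
          using S by (intro dens[rule_format] conjI)
        moreover have "card J \<le> card (edges_within G ?S)"
          using J AE finite_edges
          by (intro card_mono) (auto simp: edges_within_def)
        moreover have "(\<Union>e\<in>J. ends G e \<times> {..<\<rho>}) = ?S \<times> {..<\<rho>}" by auto
        ultimately show ?thesis by (simp add: card_cartesian_product mult.commute)
      qed simp
    qed (use fin_ends in simp)
    then obtain f where f: "inj_on f ?A" "\<And>e. e \<in> ?A \<Longrightarrow> f e \<in> ends G e \<times> {..<\<rho>}" by blast
    \<comment> \<open>Within a colour class the second components agree, so injectivity of
      \<open>f\<close> passes to the end vertex \<open>fst (f e)\<close>.\<close>
    define P where "P i = {e \<in> ?A. snd (f e) = i}" for i
    have "P i \<in> snd (pseudoforest_matroid G)" for i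
    proof (rule pseudoforest_if_injective_end[OF assms(1), of _ "fst \<circ> f"])
      show "P i \<subseteq> edges G" using AE by (auto simp: P_def)
      show "inj_on (fst \<circ> f) (P i)"
        using f(1) by (auto simp: P_def inj_on_def prod_eq_iff)
      show "(fst \<circ> f) e \<in> ends G e" if "e \<in> P i" for e
        using f(2)[of e] that by (auto simp: P_def)
    qed
    moreover have "(\<Union>i<\<rho>. P i) = ?A" using f(2) by (fastforce simp: P_def)
    moreover have "disjoint_family_on P {..<\<rho>}" by (auto simp: P_def disjoint_family_on_def)
    moreover have "?A \<subseteq> fst (pseudoforest_matroid G)"
      using AE by (simp add: pseudoforest_matroid_def)
    ultimately show "?A \<in> snd (fold_union \<rho> (pseudoforest_matroid G))"
      unfolding fold_union_def snd_conv mem_Collect_eq by blast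
  qed
qed

end
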